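(* Let $0<\epsilon,\delta<1$ with $\epsilon+\delta<1$, and suppose that each of the candidate distributions $\mathcal{C}_1,\dots,\mathcal{C}_K$ satisfies the $(\epsilon,\delta)$-lower deviation inequality. Then for every $\alpha$ with $\epsilon+\delta\le\alpha<1$, $$\mathrm{PoF}(\alpha)\le\frac{1}{1-\alpha}.$$ If in addition $\epsilon+\delta\le 1/2$, then for every such $\alpha$, $\mathrm{PoF}(\alpha)\le 1+2\alpha$.
   Context: There are $K\ge 1$ groups. For each group $i$, the number of candidates $C_i\ge 0$ is a real-valued random variable with distribution $\mathcal{C}_i$ and finite mean $\mathbb{E}[C_i]>0$; the $C_i$ are independent. There are $R$ units of resource, $R$ a positive integer. An allocation is a vector $\mathbf{v}=[v_1,\dots,v_K]$ of nonnegative reals (fractional allocations are allowed) with $\sum_i v_i=R$. Utilization: $U(\mathbf{v},\{\mathcal{C}_i\})=\sum_{i=1}^K\mathbb{E}[\min(C_i,v_i)]$. Availability: $q(v_i,\mathcal{C}_i)=\mathbb{E}[\min(C_i,v_i)]/\mathbb{E}[C_i]$. Fairness: $Q(\mathbf{v},\{\mathcal{C}_i\})=\max_{i,j}|q(v_i,\mathcal{C}_i)-q(v_j,\mathcal{C}_j)|$. Price of Fairness: $\mathrm{PoF}(\alpha)$ is the maximum of $U(\mathbf{v},\{\mathcal{C}_i\})$ over all allocations $\mathbf{v}$, divided by the maximum of $U(\mathbf{v},\{\mathcal{C}_i\})$ over all allocations $\mathbf{v}$ satisfying $Q(\mathbf{v},\{\mathcal{C}_i\})\le\alpha$. A random variable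 $X$ (or its distribution) satisfies the $(\epsilon,\delta)$-lower deviation inequality if $\Pr[X\le(1-\epsilon)\mathbb{E}[X]]\le\delta$. *)

theory Defs
  imports "HOL-Probability.Probability"
begin

text \<open>
  The groups are the elements of a finite type \<open>'k\<close>, so the number of groups is \<open>CARD('k)\<close>, which
  is at least 1. A family of candidate distributions is a map \<open>D\<close> from groups to measures on the
  reals, and the allocations are vectors in \<open>real ^ 'k\<close>.
\<close>

definition allocations :: "nat \<Rightarrow> (real ^ 'k) set" where
  "allocations R = {v. (\<forall>i. 0 \<le> v $ i) \<and> (\<Sum>i\<in>UNIV. v $ i) = real R}"

definition utilization :: "('k \<Rightarrow> real measure) \<Rightarrow> real ^ 'k \<Rightarrow> real" where
  "utilization D v = (\<Sum>i\<in>UNIV. \<integral>x. min x (v $ i) \<partial>D i)"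

definition availability :: "real measure \<Rightarrow> real \<Rightarrow> real" where
  "availability D r = (\<integral>x. min x r \<partial>D) / (\<integral>x. x \<partial>D)"

text \<open>A larger value means a less fair allocation.\<close>

definition fairness :: "('k::finite \<Rightarrow> real measure) \<Rightarrow> real ^ 'k \<Rightarrow> real" where
  "fairness D v = (MAX (i, j)\<in>UNIV. \<bar>availability (D i) (v $ i) - availability (D j) (v $ j)\<bar>)"

definition fair_allocations :: "nat \<Rightarrow> ('k::finite \<Rightarrow> real measure) \<Rightarrow> real \<Rightarrow> (real ^ 'k) set" where
  "fair_allocations R D \<alpha> = {v \<in> allocations R. fairness D v \<le> \<alpha>}"

text \<open>
  \<open>GREATEST\<close> denotes an attained maximum; unlike a supremum, its value is unspecified
  if no maximum exists.
\<close>

definition price_of_fairness :: "nat \<Rightarrow> ('k::finite \<Rightarrow> real measure) \<Rightarrow> real \<Rightarrow> real" where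
  "price_of_fairness R D \<alpha> =
     (GREATEST u. u \<in> utilization D ` allocations R) /
     (GREATEST u. u \<in> utilization D ` fair_allocations R D \<alpha>)"

definition lower_deviation :: "real \<Rightarrow> real \<Rightarrow> real measure \<Rightarrow> bool" where
  "lower_deviation \<epsilon> \<delta> D \<longleftrightarrow> measure D {..(1 - \<epsilon>) * (\<integral>x. x \<partial>D)} \<le> \<delta>"

end

theory Submission
  imports Defs
begin

text \<open>
  The allocation proportional to the mean demands is fair enough and nearly optimal. Let \<open>S\<close> be the
  total mean demand and \<open>t = R / S\<close>. Giving group \<open>i\<close> the amount \<open>t * E[C i]\<close>, its availability is at
  most \<open>min 1 t\<close>, and by the lower deviation inequality at least
  \<open>(1 - \<delta>) * min (1 - \<epsilon>) t \<ge> (1 - \<epsilon> - \<delta>) * min 1 t\<close>. Hence the allocation has fairness at most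
  \<open>\<epsilon> + \<delta>\<close> and utilization at least \<open>(1 - \<epsilon> - \<delta>) * min R S\<close>, whereas no allocation has a
  utilization above \<open>min R S\<close>. So the price of fairness is at most \<open>1 / (1 - \<epsilon> - \<delta>)\<close>.
\<close>

section \<open>Truncated means of a single candidate distribution\<close>

locale nonneg_distribution = prob_space D for D :: "real measure" +
  assumes sets_D [measurable_cong]: "sets D = sets borel"
    and nonneg: "AE x in D. 0 \<le> x"
    and integrable_ident: "integrable D (\<lambda>x. x)"
    and mean_pos: "0 < (\<integral>x. x \<partial>D)"
begin

lemma space_D: "space D = UNIV"
  using sets_D sets_eq_imp_space_eq[of D borel] by simp

lemma integrable_min: "integrable D (\<lambda>x. min x r)"
  using integrable_ident by (intro integrable_min) auto

lemma expected_min_le_mean: "(\<integral>x. min x r \<partial>D) \<le> (\<integral>x. x \<partial>D)"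
  by (intro integral_mono integrable_min integrable_ident) auto

lemma expected_min_le: "(\<integral>x. min x r \<partial>D) \<le> r"
proof -
  have "(\<integral>x. min x r \<partial>D) \<le> (\<integral>x. r \<partial>D)"
    by (intro integral_mono integrable_min) auto
  then show ?thesis by (simp add: prob_space)
qed

text \<open>For each fixed \<open>x\<close>, moving the threshold from \<open>s\<close> to
  \<open>r\<close> changes the minimum by at most the distance of the two. Applied in both
  directions this makes the truncated mean 1-Lipschitz, hence continuous, in the threshold.\<close>

lemma expected_min_diff_le: "(\<integral>x. min x r \<partial>D) - (\<integral>x. min x s \<partial>D) \<le> \<bar>r - s\<bar>"
proof -
  have "(\<integral>x. min x r \<partial>D) \<le> (\<integral>x. min x s + \<bar>r - s\<bar> \<partial>D)"
    by (intro integral_mono integrable_min Bochner_Integration.integrable_add) auto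
  also have "\<dots> = (\<integral>x. min x s \<partial>D) + \<bar>r - s\<bar>"
    using integrable_min by (simp add: prob_space)
  finally show ?thesis by simp
qed

lemma continuous_on_expected_min: "continuous_on A (\<lambda>r. \<integral>x. min x r \<partial>D)"
proof -
  have "1-lipschitz_on A (\<lambda>r. \<integral>x. min x r \<partial>D)"
  proof (rule lipschitz_onI)
    fix r s
    show "dist (\<integral>x. min x r \<partial>D) (\<integral>x. min x s \<partial>D) \<le> 1 * dist r s"
      using expected_min_diff_le[of r s] expected_min_diff_le[of s r]
      by (simp add: dist_real_def abs_le_iff abs_minus_commute)
  qed simp
  then show ?thesis by (rule lipschitz_on_continuous_on)
qed

text \<open>A Markov-type estimate: on the event that demand exceeds \<open>?a\<close>, of
  probability at least \<open>1 - \<delta>\<close>, the integrand is at least \<open>?c\<close>;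
  elsewhere it is almost surely nonnegative.\<close>

lemma expected_min_ge:
  assumes dev: "lower_deviation \<epsilon> \<delta> D" and r: "0 \<le> r" and \<epsilon>: "\<epsilon> \<le> 1"
  shows "(1 - \<delta>) * min ((1 - \<epsilon>) * (\<integral>x. x \<partial>D)) r \<le> (\<integral>x. min x r \<partial>D)"
proof -
  let ?a = "(1 - \<epsilon>) * (\<integral>x. x \<partial>D)"
  let ?c = "min ?a r"
  have c: "0 \<le> ?c" using \<epsilon> mean_pos r by simp
  have "prob {?a<..} = 1 - prob {..?a}"
    using prob_compl[of "{..?a}"] by (simp add: space_D sets_D flip: Compl_eq_Diff_UNIV)
  then have "1 - \<delta> \<le> prob {?a<..}"
    using dev by (simp add: lower_deviation_def)
  then have "(1 - \<delta>) * ?c \<le> prob {?a<..} * ?c"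
    using c by (rule mult_right_mono)
  also have "\<dots> = (\<integral>x. indicator {?a<..} x * ?c \<partial>D)"
    by (simp add: space_D)
  also have "\<dots> \<le> (\<integral>x. min x r \<partial>D)"
  proof (rule integral_mono_AE)
    show "integrable D (\<lambda>x. indicator {?a<..} x * ?c)"
      by (intro integrable_mult_left integrable_real_indicator) (auto simp: sets_D emeasure_eq_measure)
    show "AE x in D. indicator {?a<..} x * ?c \<le> min x r"
      using nonneg by eventually_elim (use r in \<open>auto simp: indicator_def\<close>)
  qed (rule integrable_min)
  finally show ?thesis .
qed

lemma availability_le: "availability D (t * (\<integral>x. x \<partial>D)) \<le> min 1 t"
  using expected_min_le_mean[of "t * (\<integral>x. x \<partial>D)"] expected_min_le[of "t * (\<integral>x. x \<partial>D)"] mean_pos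
  by (simp add: availability_def divide_le_eq)

lemma availability_ge:
  assumes dev: "lower_deviation \<epsilon> \<delta> D" and t: "0 \<le> t"
    and "0 \<le> \<epsilon>" "\<epsilon> \<le> 1" "0 \<le> \<delta>" "\<delta> \<le> 1"
  shows "(1 - (\<epsilon> + \<delta>)) * min 1 t \<le> availability D (t * (\<integral>x. x \<partial>D))"
proof -
  let ?m = "\<integral>x. x \<partial>D"
  have "(1 - (\<epsilon> + \<delta>)) * min 1 t \<le> (1 - \<delta>) * ((1 - \<epsilon>) * min 1 t)"
  proof -
    \<comment> \<open>This product is exactly the gap between the two sides, by expanding
      \<open>(1 - \<delta>) * (1 - \<epsilon>)\<close>.\<close>
    have "0 \<le> \<epsilon> * \<delta> * min 1 t" using assms by simp
    then show ?thesis by (simp add: algebra_simps)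
  qed
  also have "\<dots> \<le> (1 - \<delta>) * min (1 - \<epsilon>) t"
  proof (intro mult_left_mono min.boundedI)
    show "(1 - \<epsilon>) * min 1 t \<le> 1 - \<epsilon>"
      using assms by (intro mult_left_le) auto
    show "(1 - \<epsilon>) * min 1 t \<le> t"
      using assms mult_left_le_one_le[of "min 1 t" "1 - \<epsilon>"] by auto
  qed (use assms in auto)
  also have "\<dots> \<le> availability D (t * ?m)"
  proof -
    have "min ((1 - \<epsilon>) * ?m) (t * ?m) = min (1 - \<epsilon>) t * ?m"
      using mean_pos by (simp add: min_def)
    then show ?thesis
      using expected_min_ge[OF dev, of "t * ?m"] assms mean_pos
      by (simp add: availability_def le_divide_eq mult.assoc)
  qed
  finally show ?thesis .
qed

end

section \<open>Compactness and attained maxima\<close>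

lemma compact_allocations: "compact (allocations R :: (real ^ 'k::finite) set)"
proof (rule compact_Int_closed[of "cbox 0 (\<chi> i. real R)" "allocations R", THEN back_subst[of compact]])
  show "closed (allocations R :: (real ^ 'k) set)"
    unfolding allocations_def
    by (intro closed_Collect_conj closed_Collect_all closed_Collect_le closed_Collect_eq
        continuous_intros)
  \<comment> \<open>A coordinate is at most the sum of all of them, so the closed set of allocations
    already lies in a compact box and intersecting with the box changes nothing.\<close>
  have "v $ i \<le> real R" if "v \<in> allocations R" for v :: "real ^ 'k" and i
    using that member_le_sum[of i UNIV "\<lambda>i. v $ i"] by (auto simp: allocations_def)
  then show "cbox 0 (\<chi> i. real R) \<inter> allocations R = (allocations R :: (real ^ 'k) set)"
    by (auto simp: mem_box_cart allocations_def)
qed simp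

lemma fairness_le_iff:
  "fairness D v \<le> \<alpha> \<longleftrightarrow>
     (\<forall>i j. \<bar>availability (D i) (v $ i) - availability (D j) (v $ j)\<bar> \<le> \<alpha>)"
  unfolding fairness_def by (subst Max_le_iff) auto

text \<open>\<open>GREATEST\<close> says nothing until a maximum is known to exist; compactness and
  continuity supply a maximizer, after which it may be used as an upper bound that is
  attained.\<close>

lemma Greatest_image_compact:
  fixes f :: "'a::topological_space \<Rightarrow> real"
  assumes "compact A" "A \<noteq> {}" "continuous_on A f"
  shows "(GREATEST u. u \<in> f ` A) \<in> f ` A"
    and "\<And>x. x \<in> A \<Longrightarrow> f x \<le> (GREATEST u. u \<in> f ` A)"
proof -
  obtain x where x: "x \<in> A" "\<forall>y\<in>A. f y \<le> f x"
    using continuous_attains_sup[OF assms] by blast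
  then have "(GREATEST u. u \<in> f ` A) = f x"
    by (intro Greatest_equality) auto
  then show "(GREATEST u. u \<in> f ` A) \<in> f ` A"
    and "\<And>x. x \<in> A \<Longrightarrow> f x \<le> (GREATEST u. u \<in> f ` A)"
    using x by auto
qed

section \<open>The proportional allocation and the price of fairness\<close>

context
  fixes D :: "'k::finite \<Rightarrow> real measure" and R :: nat and \<epsilon> \<delta> :: real
  assumes D: "\<And>i. nonneg_distribution (D i)"
    and dev: "\<And>i. lower_deviation \<epsilon> \<delta> (D i)"
    and R: "0 < R"
    and \<epsilon>\<delta>: "0 \<le> \<epsilon>" "0 \<le> \<delta>" "\<epsilon> + \<delta> < 1"
begin

lemma continuous_on_utilization: "continuous_on A (utilization D)"
  unfolding utilization_def
  by (intro continuous_on_sum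
      continuous_on_compose2[OF nonneg_distribution.continuous_on_expected_min[OF D, of UNIV]]
      continuous_intros) auto

text \<open>The fairness constraint is a conjunction of non-strict inequalities between continuous
  functions, so it cuts a closed subset out of a compact set.\<close>

lemma compact_fair_allocations: "compact (fair_allocations R D \<alpha>)"
proof -
  have cont: "continuous_on UNIV (\<lambda>v. availability (D i) (v $ i))" for i
    unfolding availability_def
    using nonneg_distribution.mean_pos[OF D, of i]
    by (intro continuous_on_divide continuous_on_const
        continuous_on_compose2[OF nonneg_distribution.continuous_on_expected_min[OF D, of UNIV]]
        continuous_intros) auto
  have "closed {v. fairness D v \<le> \<alpha>}"
    unfolding fairness_le_iff
    by (intro closed_Collect_all closed_Collect_le continuous_on_rabs continuous_on_diff cont
        continuous_on_const)
  then have "compact (allocations R \<inter> {v. fairness D v \<le> \<alpha>})"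
    by (intro compact_Int_closed compact_allocations)
  then show ?thesis
    by (simp add: fair_allocations_def Int_def)
qed

abbreviation total_mean :: real where
  "total_mean \<equiv> \<Sum>i\<in>UNIV. \<integral>x. x \<partial>D i"

lemma total_mean_pos: "0 < total_mean"
  using nonneg_distribution.mean_pos[OF D] by (intro sum_pos) auto

lemma utilization_le:
  assumes "v \<in> allocations R"
  shows "utilization D v \<le> min (real R) total_mean"
proof -
  have "utilization D v \<le> (\<Sum>i\<in>UNIV. v $ i)"
    unfolding utilization_def
    by (intro sum_mono nonneg_distribution.expected_min_le[OF D])
  moreover have "utilization D v \<le> total_mean"
    unfolding utilization_def
    by (intro sum_mono nonneg_distribution.expected_min_le_mean[OF D])
  ultimately show ?thesis
    using assms by (simp add: allocations_def)
qed

definition proportional :: "real ^ 'k" where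
  "proportional = (\<chi> i. real R / total_mean * (\<integral>x. x \<partial>D i))"

lemma availability_proportional_le:
  "availability (D i) (proportional $ i) \<le> min 1 (real R / total_mean)"
  unfolding proportional_def vec_lambda_beta
  by (rule nonneg_distribution.availability_le[OF D])

lemma availability_proportional_ge:
  "(1 - (\<epsilon> + \<delta>)) * min 1 (real R / total_mean) \<le> availability (D i) (proportional $ i)"
  unfolding proportional_def vec_lambda_beta
  using \<epsilon>\<delta> total_mean_pos
  by (intro nonneg_distribution.availability_ge[OF D dev]) auto

lemma proportional_fair: "proportional \<in> fair_allocations R D (\<epsilon> + \<delta>)"
proof -
  have "proportional \<in> allocations R"
    using total_mean_pos less_imp_le[OF nonneg_distribution.mean_pos[OF D]]
    by (auto simp: allocations_def proportional_def simp flip: sum_distrib_left sum_divide_distrib)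
  moreover have "fairness D proportional \<le> \<epsilon> + \<delta>"
  proof -
    let ?s = "min 1 (real R / total_mean)"
    \<comment> \<open>As \<open>?s\<close> is at most 1, the multiplicative loss is at most an
      additive one: all availabilities lie between \<open>?s - (\<epsilon> + \<delta>)\<close> and
      \<open>?s\<close>, so any two differ by at most \<open>\<epsilon> + \<delta>\<close>.\<close>
    have "(\<epsilon> + \<delta>) * ?s \<le> \<epsilon> + \<delta>"
      using \<epsilon>\<delta> by (intro mult_left_le) auto
    then have ge: "?s - (\<epsilon> + \<delta>) \<le> availability (D i) (proportional $ i)" for i
      using availability_proportional_ge[of i] by (simp only: left_diff_distrib mult_1)
    show ?thesis
      unfolding fairness_le_iff
    proof (intro allI)
      fix i j
      show "\<bar>availability (D i) (proportional $ i) - availability (D j) (proportional $ j)\<bar> \<le> \<epsilon> + \<delta>"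
        using availability_proportional_le[of i] availability_proportional_le[of j] ge[of i] ge[of j]
        by linarith
    qed
  qed
  ultimately show ?thesis by (simp add: fair_allocations_def)
qed

text \<open>Utilization is the sum of the availabilities weighted by the mean demands, so a lower
  bound common to all groups is simply multiplied by \<open>total_mean\<close>.\<close>

lemma utilization_proportional_ge:
  "(1 - (\<epsilon> + \<delta>)) * min (real R) total_mean \<le> utilization D proportional"
proof -
  let ?s = "min 1 (real R / total_mean)"
  have "min (real R) total_mean = ?s * total_mean"
    using total_mean_pos by (simp add: min_def field_simps)
  then have "(1 - (\<epsilon> + \<delta>)) * min (real R) total_mean =
      (\<Sum>i\<in>UNIV. (1 - (\<epsilon> + \<delta>)) * ?s * (\<integral>x. x \<partial>D i))"
    by (simp only: mult.assoc sum_distrib_left)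
  also have "\<dots> \<le> (\<Sum>i\<in>UNIV. availability (D i) (proportional $ i) * (\<integral>x. x \<partial>D i))"
    using nonneg_distribution.mean_pos[OF D]
    by (intro sum_mono mult_right_mono availability_proportional_ge) (auto intro: less_imp_le)
  also have "\<dots> = utilization D proportional"
    unfolding utilization_def availability_def
    using nonneg_distribution.mean_pos[OF D]
    by (intro sum.cong) (auto simp: less_imp_neq[symmetric])
  finally show ?thesis .
qed

text \<open>Relaxing the tolerance from \<open>\<epsilon> + \<delta>\<close> to
  \<open>\<alpha>\<close> keeps \<open>proportional\<close> feasible, so one bound serves all such
  \<open>\<alpha>\<close>.\<close>

lemma price_of_fairness_le:
  assumes "\<epsilon> + \<delta> \<le> \<alpha>"
  shows "price_of_fairness R D \<alpha> \<le> 1 / (1 - (\<epsilon> + \<delta>))"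
proof -
  let ?m = "min (real R) total_mean"
  let ?opt = "GREATEST u. u \<in> utilization D ` allocations R"
  let ?fair = "GREATEST u. u \<in> utilization D ` fair_allocations R D \<alpha>"
  have proportional: "proportional \<in> fair_allocations R D \<alpha>"
    using proportional_fair assms by (auto simp: fair_allocations_def)
  then have "allocations R \<noteq> ({} :: (real ^ 'k) set)"
    by (auto simp: fair_allocations_def)
  then have opt: "?opt \<le> ?m"
    using Greatest_image_compact(1)[OF compact_allocations _ continuous_on_utilization, of R]
      utilization_le by auto
  have "(1 - (\<epsilon> + \<delta>)) * ?m \<le> utilization D proportional"
    by (rule utilization_proportional_ge)
  also have "\<dots> \<le> ?fair"
    using proportional
    by (intro Greatest_image_compact(2) compact_fair_allocations continuous_on_utilization) auto
  finally have fair: "(1 - (\<epsilon> + \<delta>)) * ?m \<le> ?fair" .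
  have m: "0 < ?m" using R total_mean_pos by simp
  then have "0 < (1 - (\<epsilon> + \<delta>)) * ?m" using \<epsilon>\<delta> by simp
  \<comment> \<open>The denominator of the price of fairness is positive, so the quotient can be
    bounded by cross-multiplication.\<close>
  with fair have "0 < ?fair" by linarith
  moreover have "?opt \<le> 1 / (1 - (\<epsilon> + \<delta>)) * ?fair"
  proof -
    have "(1 - (\<epsilon> + \<delta>)) * ?opt \<le> ?fair"
      using mult_left_mono[OF opt, of "1 - (\<epsilon> + \<delta>)"] fair \<epsilon>\<delta> by linarith
    then show ?thesis
      using \<epsilon>\<delta> by (simp add: pos_le_divide_eq mult.commute)
  qed
  ultimately show ?thesis
    by (simp only: price_of_fairness_def pos_divide_le_eq)
qed

end

theorem theorem2:
  fixes M :: "'a measure"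
    and C :: "'k::finite \<Rightarrow> 'a \<Rightarrow> real"
    and D :: "'k \<Rightarrow> real measure"
    and R :: nat
    and \<epsilon> \<delta> :: real
  assumes "prob_space M"
    and "prob_space.indep_vars M (\<lambda>_. borel) C UNIV"
    and "\<And>i. D i = distr M borel (C i)"
    and "\<And>i. AE \<omega> in M. 0 \<le> C i \<omega>"
    and "\<And>i. integrable M (C i)"
    and "\<And>i. 0 < (\<integral>\<omega>. C i \<omega> \<partial>M)"
    and "0 < R"
    and "0 < \<epsilon>" "\<epsilon> < 1" "0 < \<delta>" "\<delta> < 1" "\<epsilon> + \<delta> < 1"
    and "\<And>i. lower_deviation \<epsilon> \<delta> (D i)"
  shows "(\<forall>\<alpha>. \<epsilon> + \<delta> \<le> \<alpha> \<and> \<alpha> < 1 \<longrightarrow> price_of_fairness R D \<alpha> \<le> 1 / (1 - \<alpha>)) \<and>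
         (\<epsilon> + \<delta> \<le> 1 / 2 \<longrightarrow>
            (\<forall>\<alpha>. \<epsilon> + \<delta> \<le> \<alpha> \<and> \<alpha> < 1 \<longrightarrow> price_of_fairness R D \<alpha> \<le> 1 + 2 * \<alpha>))"
proof -
  \<comment> \<open>The assumptions on the random variables are carried over to their distributions
    by change of variables.\<close>
  have D: "nonneg_distribution (D i)" for i
  proof -
    have [measurable]: "C i \<in> borel_measurable M"
      using assms(5) by (rule borel_measurable_integrable)
    interpret M: prob_space M by fact
    interpret D: prob_space "distr M borel (C i)"
      by (rule M.prob_space_distr) simp
    show ?thesis
      unfolding assms(3) using assms(4,5,6)
      by unfold_locales (auto simp: AE_distr_iff integrable_distr_eq integral_distr)
  qed
  have bound: "price_of_fairness R D \<alpha> \<le> 1 / (1 - (\<epsilon> + \<delta>))" if "\<epsilon> + \<delta> \<le> \<alpha>" for \<alpha>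
    using assms D that by (intro price_of_fairness_le) auto
  have "1 / (1 - (\<epsilon> + \<delta>)) \<le> 1 / (1 - \<alpha>)" if "\<epsilon> + \<delta> \<le> \<alpha>" "\<alpha> < 1" for \<alpha>
    using that by (intro divide_left_mono) auto
  \<comment> \<open>The linear bound is proved at \<open>\<epsilon> + \<delta>\<close> and only then
    weakened to \<open>\<alpha>\<close>, since \<open>\<alpha>\<close> itself may exceed 1/2. With
    denominators cleared it says that \<open>x * (1 - 2 * x)\<close> is nonnegative for
    \<open>x = \<epsilon> + \<delta>\<close>.\<close>
  moreover have "1 / (1 - (\<epsilon> + \<delta>)) \<le> 1 + 2 * (\<epsilon> + \<delta>)" if "\<epsilon> + \<delta> \<le> 1 / 2"
  proof -
    have "0 \<le> (\<epsilon> + \<delta>) * (1 - 2 * (\<epsilon> + \<delta>))" using that assms by simp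
    also have "\<dots> = (1 + 2 * (\<epsilon> + \<delta>)) * (1 - (\<epsilon> + \<delta>)) - 1" by (simp add: algebra_simps)
    finally show ?thesis using assms by (subst pos_divide_le_eq) auto
  qed
  ultimately show ?thesis
    using bound by (smt (verit))
qed

end
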